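(* Let $\mathcal{M}$ be a finite metric space whose elements are represented (injectively) by $n$-bit strings. Assume $(\mathsf{SS},\mathsf{Rec})$ is an $(\mathcal{M},m,\tilde m,t)$-secure sketch, and let $\mathsf{Ext}$ be an average-case $(n,\tilde m,\ell,\epsilon)$-strong extractor. Define $(\mathsf{Gen},\mathsf{Rep})$ as follows. $\mathsf{Gen}(w;r,x)$: set $P=(\mathsf{SS}(w;r),x)$ and $R=\mathsf{Ext}(w;x)$, and output $(R,P)$. $\mathsf{Rep}(w',(s,x))$: compute $\hat w=\mathsf{Rec}(w',s)$ and output $\mathsf{Ext}(\hat w;x)$. Here $r$ and $x$ are independent uniform random coins for $\mathsf{SS}$ and $\mathsf{Ext}$. Then $(\mathsf{Gen},\mathsf{Rep})$ is an $(\mathcal{M},m,\ell,t,\epsilon)$-fuzzy extractor.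
   Context: All logarithms are base 2. $\mathcal{M}$ is a finite metric space with distance $\mathsf{dis}$. $f(x;r)$ denotes a randomized function with coins $r$. $U_\ell$ is the uniform distribution on $\{0,1\}^\ell$. Statistical distance: $\mathbf{SD}(A,B)=\frac12\sum_v|\Pr(A=v)-\Pr(B=v)|$. Min-entropy: $\mathbf{H}_\infty(A)=-\log\max_a\Pr[A=a]$. Average min-entropy: $\tilde{\mathbf{H}}_\infty(A\mid B)=-\log\big(\mathbb{E}_{b\leftarrow B}[\max_a\Pr[A=a\mid B=b]]\big)$. An $(\mathcal{M},m,\tilde m,t)$-secure sketch is a pair of randomized procedures: $\mathsf{SS}$ maps $w\in\mathcal{M}$ to a bit string; $\mathsf{Rec}$ takes $w'\in\mathcal{M}$ and a bit string; correctness: if $\mathsf{dis}(w,w')\le t$ then $\mathsf{Rec}(w',\mathsf{SS}(w))=w$; security: for every distribution $W$ on $\mathcal{M}$ with min-entropy at least $m$, $\tilde{\mathbf{H}}_\infty(W\mid\mathsf{SS}(W))\ge\tilde m$. A randomized function $\mathsf{Ext}:\{0,1\}^n\to\{0,1\}^\ell$ with $\rho$ bits of randomness is an average-case $(n,m,\ell,\epsilon)$-strong extractor if for all pairs of random variables $(W,I)$ with $W$ an $n$-bit string and $\tilde{\mathbf{H}}_\infty(W\mid I)\ge m$, $\mathbf{SD}((\mathsf{Ext}(W;X),X,I),(U_\ell,X,I))\le\epsilon$, where $X$ is uniform on $\{0,1\}^\rho$ and independent of $(W,I)$. An $(\mathcal{M},m,\ell,t,\epsilon)$-fuzzy extractor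 is a pair of randomized procedures: $\mathsf{Gen}$ maps $w\in\mathcal{M}$ to $(R,P)$ with $R\in\{0,1\}^\ell$, $P\in\{0,1\}^*$; $\mathsf{Rep}$ takes $w'\in\mathcal{M}$ and $P$; correctness: if $\mathsf{dis}(w,w')\le t$ and $(R,P)\leftarrow\mathsf{Gen}(w)$ then $\mathsf{Rep}(w',P)=R$; security: for every distribution $W$ on $\mathcal{M}$ of min-entropy at least $m$, if $(R,P)\leftarrow\mathsf{Gen}(W)$ then $\mathbf{SD}((R,P),(U_\ell,P))\le\epsilon$. *)

theory Defs
  imports "HOL-Probability.Probability"
begin

text \<open>
  Bit strings are values of type \<^typ>\<open>bool list\<close>, and \<open>{0,1}\<^sup>n\<close> is \<open>bits n\<close>. A random variable is
  represented by its distribution, jointly distributed variables by a distribution on tuples.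
  A randomized procedure is a function into distributions; a randomized function \<open>f(a;r)\<close> with
  explicit coins \<open>r\<close> induces the procedure that runs \<open>f\<close> on uniform coins.
\<close>

definition bits :: "nat \<Rightarrow> bool list set" where
  "bits n = {xs. length xs = n}"

definition unif :: "nat \<Rightarrow> bool list pmf" where
  "unif n = pmf_of_set (bits n)"

text \<open>The series below always converges, being dominated by the sum of the two mass functions.\<close>

definition SD :: "'a pmf \<Rightarrow> 'a pmf \<Rightarrow> real" where
  "SD A B = 1 / 2 * (\<Sum>\<^sub>\<infinity>v. \<bar>pmf A v - pmf B v\<bar>)"

text \<open>The suprema are the maxima of the usual definitions: point masses are bounded by 1, and only
  finitely many of them exceed any given positive number.\<close>

definition min_entropy :: "'a pmf \<Rightarrow> real" where
  "min_entropy A = - log 2 (SUP a. pmf A a)"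

text \<open>The average min-entropy of the first component of a pair given the second one.\<close>

definition avg_min_entropy :: "('a \<times> 'b) pmf \<Rightarrow> real" where
  "avg_min_entropy AB =
     - log 2 (measure_pmf.expectation (map_pmf snd AB)
         (\<lambda>b. SUP a. \<P>(v in measure_pmf AB. fst v = a \<bar> snd v = b)))"

definition secure_sketch ::
  "'m set \<Rightarrow> ('m \<Rightarrow> 'm \<Rightarrow> real) \<Rightarrow> real \<Rightarrow> real \<Rightarrow> real \<Rightarrow>
   ('m \<Rightarrow> bool list pmf) \<Rightarrow> ('m \<Rightarrow> bool list \<Rightarrow> 'm pmf) \<Rightarrow> bool" where
  "secure_sketch M dis m m' t SS Rec \<longleftrightarrow>
     (\<forall>w\<in>M. \<forall>w'\<in>M. dis w w' \<le> t \<longrightarrow>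
        (\<forall>s\<in>set_pmf (SS w). Rec w' s = return_pmf w)) \<and>
     (\<forall>W. set_pmf W \<subseteq> M \<and> min_entropy W \<ge> m \<longrightarrow>
        avg_min_entropy (bind_pmf W (\<lambda>w. map_pmf (\<lambda>s. (w, s)) (SS w))) \<ge> m')"

text \<open>The side information \<open>I\<close> ranges over discrete random variables; up to an injective renaming of
  their values these are the random variables with values in \<^typ>\<open>bool list\<close>. In the triples, the
  seed is drawn independently of \<open>(W, I)\<close>.\<close>

definition avg_strong_extractor ::
  "nat \<Rightarrow> real \<Rightarrow> nat \<Rightarrow> real \<Rightarrow> nat \<Rightarrow> (bool list \<Rightarrow> bool list \<Rightarrow> bool list) \<Rightarrow> bool" where
  "avg_strong_extractor n m l \<epsilon> \<rho> Ext \<longleftrightarrow>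
     (\<forall>w\<in>bits n. \<forall>x\<in>bits \<rho>. Ext w x \<in> bits l) \<and>
     (\<forall>WI :: (bool list \<times> bool list) pmf.
        fst ` set_pmf WI \<subseteq> bits n \<and> avg_min_entropy WI \<ge> m \<longrightarrow>
        SD (map_pmf (\<lambda>((w, i), x). (Ext w x, x, i)) (pair_pmf WI (unif \<rho>)))
           (pair_pmf (unif l) (pair_pmf (unif \<rho>) (map_pmf snd WI))) \<le> \<epsilon>)"

definition fuzzy_extractor ::
  "'m set \<Rightarrow> ('m \<Rightarrow> 'm \<Rightarrow> real) \<Rightarrow> real \<Rightarrow> nat \<Rightarrow> real \<Rightarrow> real \<Rightarrow>
   ('m \<Rightarrow> (bool list \<times> bool list) pmf) \<Rightarrow> ('m \<Rightarrow> bool list \<Rightarrow> bool list pmf) \<Rightarrow> bool" where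
  "fuzzy_extractor M dis m l t \<epsilon> Gen Rep \<longleftrightarrow>
     (\<forall>w\<in>M. \<forall>(R, P)\<in>set_pmf (Gen w). R \<in> bits l) \<and>
     (\<forall>w\<in>M. \<forall>w'\<in>M. dis w w' \<le> t \<longrightarrow>
        (\<forall>(R, P)\<in>set_pmf (Gen w). Rep w' P = return_pmf R)) \<and>
     (\<forall>W. set_pmf W \<subseteq> M \<and> min_entropy W \<ge> m \<longrightarrow>
        SD (bind_pmf W Gen) (pair_pmf (unif l) (map_pmf snd (bind_pmf W Gen))) \<le> \<epsilon>)"

text \<open>
  In the construction, \<open>repr\<close> represents points of the metric space by bit strings, and
  \<open>enc\<close>/\<open>dec\<close> is the encoding of the pair \<open>(s, x)\<close> as one bit string.
\<close>

definition sketch_gen ::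
  "('m \<Rightarrow> bool list) \<Rightarrow> (bool list \<Rightarrow> bool list \<Rightarrow> bool list) \<Rightarrow>
   ('m \<Rightarrow> bool list \<Rightarrow> bool list) \<Rightarrow> (bool list \<Rightarrow> bool list \<Rightarrow> bool list) \<Rightarrow>
   'm \<Rightarrow> bool list \<Rightarrow> bool list \<Rightarrow> bool list \<times> bool list" where
  "sketch_gen repr enc SS Ext w r x =
     (let P = enc (SS w r) x; R = Ext (repr w) x in (R, P))"

text \<open>The last argument \<open>c\<close> of the reproduction procedure is the coins of \<open>Rec\<close>.\<close>

definition sketch_rep ::
  "('m \<Rightarrow> bool list) \<Rightarrow> (bool list \<Rightarrow> bool list \<times> bool list) \<Rightarrow>
   ('m \<Rightarrow> bool list \<Rightarrow> bool list \<Rightarrow> 'm) \<Rightarrow> (bool list \<Rightarrow> bool list \<Rightarrow> bool list) \<Rightarrow>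
   'm \<Rightarrow> bool list \<Rightarrow> bool list \<Rightarrow> bool list" where
  "sketch_rep repr dec Rec Ext w' P c =
     (let (s, x) = dec P; w = Rec w' s c in Ext (repr w) x)"

text \<open>Since seeds have a fixed length, concatenation is one such encoding.\<close>

lemma append_encoding:
  assumes "x \<in> bits \<rho>"
  shows "(\<lambda>p. (take (length p - \<rho>) p, drop (length p - \<rho>) p)) (s @ x) = (s, x)"
  using assms by (simp add: bits_def)

end

theory Submission
  imports Defs
begin

text \<open>
  Correctness of the sketch recovers \<open>w\<close> itself, so \<open>Rep\<close> recomputes the same extraction. For
  security, an injective representation preserves average min-entropy, so the extractor applies
  to the represented input with the sketch as side information; the triple \<open>(R, x, s)\<close> is then
  turned into \<open>(R, enc s x)\<close>, and this map is injective, hence preserves statistical distance.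
\<close>

lemma set_pmf_unif: "set_pmf (unif n) = bits n"
proof -
  have "finite (bits n)"
    using finite_lists_length_eq[of "UNIV :: bool set" n] by (simp add: bits_def)
  moreover have "replicate n False \<in> bits n"
    by (simp add: bits_def)
  ultimately show ?thesis
    unfolding unif_def by (metis empty_iff set_pmf_of_set)
qed

text \<open>Correctness of the sketch is an equation between distributions; this turns it into a
  fact about each single coin string of \<open>Rec\<close>.\<close>

lemma map_pmf_eq_return_pmfD:
  assumes "map_pmf f p = return_pmf y" and "x \<in> set_pmf p"
  shows "f x = y"
  using assms by (metis imageI set_map_pmf set_return_pmf singletonD)

text \<open>Both series vanish off the supports and their images, so they restrict to the union of
  the two supports and its image, where \<open>f\<close> reindexes one into the other. Injectivity
  on the supports is enough, as needed for an encoding that is decodable only for seeds of the right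
  length.\<close>

lemma SD_map_pmf_inj:
  assumes inj: "inj_on f (set_pmf A \<union> set_pmf B)"
  shows "SD (map_pmf f A) (map_pmf f B) = SD A B"
proof -
  let ?S = "set_pmf A \<union> set_pmf B"
  have pmf_map: "pmf (map_pmf f C) (f v) = pmf C v"
    if "v \<in> ?S" and "set_pmf C \<subseteq> ?S" for v C
  proof (cases "v \<in> set_pmf C")
    case True
    then show ?thesis
      using inj that(2) by (metis inj_on_subset pmf_map_inj)
  next
    case False
    \<comment> \<open>Here \<open>v\<close> lies in the other support, so injectivity on each
      support separately would not exclude a collision.\<close>
    then have "f v \<notin> set_pmf (map_pmf f C)"
      using inj that by (auto simp: inj_on_def)
    with False show ?thesis
      by (metis pmf_eq_0_set_pmf)
  qed
  have "(\<Sum>\<^sub>\<infinity>v. \<bar>pmf (map_pmf f A) v - pmf (map_pmf f B) v\<bar>)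
      = (\<Sum>\<^sub>\<infinity>v\<in>f ` ?S. \<bar>pmf (map_pmf f A) v - pmf (map_pmf f B) v\<bar>)"
  proof (rule infsum_cong_neutral)
    fix v assume "v \<in> UNIV - f ` ?S"
    then have "v \<notin> set_pmf (map_pmf f A)" "v \<notin> set_pmf (map_pmf f B)"
      by auto
    then show "\<bar>pmf (map_pmf f A) v - pmf (map_pmf f B) v\<bar> = 0"
      by (simp only: set_pmf_iff not_not)
  qed auto
  also have "\<dots> = (\<Sum>\<^sub>\<infinity>v\<in>?S. \<bar>pmf (map_pmf f A) (f v) - pmf (map_pmf f B) (f v)\<bar>)"
    using inj by (simp add: infsum_reindex o_def)
  also have "\<dots> = (\<Sum>\<^sub>\<infinity>v\<in>?S. \<bar>pmf A v - pmf B v\<bar>)"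
    by (rule infsum_cong) (simp add: pmf_map)
  also have "\<dots> = (\<Sum>\<^sub>\<infinity>v. \<bar>pmf A v - pmf B v\<bar>)"
    by (rule infsum_cong_neutral) (auto simp: set_pmf_iff)
  finally show ?thesis
    by (simp add: SD_def)
qed

text \<open>The second marginal is unchanged, and for each \<open>b\<close> the conditional point
  masses are only relabelled, apart from zeros outside the supports. Hence the suprema agree for
  every \<open>b\<close>.\<close>

lemma avg_min_entropy_map_fst_inj:
  assumes inj: "inj_on f (fst ` set_pmf AB)"
  shows "avg_min_entropy (map_pmf (apfst f) AB) = avg_min_entropy AB"
proof -
  let ?P = "\<lambda>b a. \<P>(v in measure_pmf AB. fst v = a \<bar> snd v = b)"
  let ?Q = "\<lambda>b c. \<P>(v in measure_pmf (map_pmf (apfst f) AB). fst v = c \<bar> snd v = b)"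
  have Q_eq: "?Q b c = \<P>(v in measure_pmf AB. f (fst v) = c \<bar> snd v = b)" for b c
    by (simp add: cond_prob_def vimage_def)
  have P_0: "?P b a = 0" if "a \<notin> fst ` set_pmf AB" for a b
    using that by (auto simp: cond_prob_def measure_pmf_zero_iff)
  have Q_0: "?Q b c = 0" if "c \<notin> f ` fst ` set_pmf AB" for b c
    unfolding Q_eq using that by (auto simp: cond_prob_def measure_pmf_zero_iff)
  have Q_P: "?Q b (f a) = ?P b a" if "a \<in> fst ` set_pmf AB" for a b
  proof -
    \<comment> \<open>The two events need only agree almost surely: off the support \<open>f\<close>
      may collide.\<close>
    have "measure (measure_pmf AB) {v. f (fst v) = f a \<and> snd v = b}
        = measure (measure_pmf AB) {v. fst v = a \<and> snd v = b}"
      by (rule measure_pmf.finite_measure_eq_AE)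
         (use inj that in \<open>auto simp: AE_measure_pmf_iff inj_on_def image_iff\<close>)
    then show ?thesis
      unfolding Q_eq by (simp add: cond_prob_def)
  qed
  \<comment> \<open>The upper bound makes the real suprema meaningful; the lower bound lets any term
    dominate a zero term. Conditioning on a null event gives 0 by the convention for
    division.\<close>
  have bounds: "0 \<le> cond_prob (measure_pmf p) R T" "cond_prob (measure_pmf p) R T \<le> 1"
    for p :: "'z pmf" and R T
  proof -
    show "0 \<le> cond_prob (measure_pmf p) R T"
      by (simp add: cond_prob_def)
    show "cond_prob (measure_pmf p) R T \<le> 1"
      unfolding cond_prob_def
      by (rule divide_le_eq_1[THEN iffD2])
         (auto simp: zero_less_measure_iff intro!: measure_pmf.finite_measure_mono)
  qed
  have "(SUP c. ?Q b c) = (SUP a. ?P b a)" for b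
  \<comment> \<open>In both directions a term from the support is matched by its relabelled
    counterpart, and a term off the support is 0, so an arbitrary index serves as witness.\<close>
  proof (rule antisym)
    show "(SUP c. ?Q b c) \<le> (SUP a. ?P b a)"
    proof (rule cSUP_mono)
      show "bdd_above (range (?P b))"
        using bounds(2) by (intro bdd_aboveI2)
      show "\<exists>a\<in>UNIV. ?Q b c \<le> ?P b a" for c
      proof (cases "c \<in> f ` fst ` set_pmf AB")
        case True
        then obtain a where "a \<in> fst ` set_pmf AB" "c = f a" by blast
        with Q_P show ?thesis by (metis UNIV_I order_refl)
      next
        case False
        then show ?thesis using Q_0 bounds(1) by (metis UNIV_I)
      qed
    qed simp
    show "(SUP a. ?P b a) \<le> (SUP c. ?Q b c)"
    proof (rule cSUP_mono)
      show "bdd_above (range (?Q b))"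
        using bounds(2) by (intro bdd_aboveI2)
      show "\<exists>c\<in>UNIV. ?P b a \<le> ?Q b c" for a
      proof (cases "a \<in> fst ` set_pmf AB")
        case True
        with Q_P show ?thesis by (metis UNIV_I order_refl)
      next
        case False
        then show ?thesis using P_0 bounds(1) by (metis UNIV_I)
      qed
    qed simp
  qed
  then show ?thesis
    by (simp add: avg_min_entropy_def map_pmf_comp)
qed

theorem lemma4p1:
  fixes M :: "'m set" and dis :: "'m \<Rightarrow> 'm \<Rightarrow> real"
    and m m' t \<epsilon> :: real and n l \<rho> k k' :: nat
    and repr :: "'m \<Rightarrow> bool list"
    and SS :: "'m \<Rightarrow> bool list \<Rightarrow> bool list"
    and Rec :: "'m \<Rightarrow> bool list \<Rightarrow> bool list \<Rightarrow> 'm"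
    and Ext :: "bool list \<Rightarrow> bool list \<Rightarrow> bool list"
    and enc :: "bool list \<Rightarrow> bool list \<Rightarrow> bool list"
    and dec :: "bool list \<Rightarrow> bool list \<times> bool list"
  assumes "Metric_space M dis" and "finite M"
    and "inj_on repr M" and "repr ` M \<subseteq> bits n"
    and "\<And>s x. x \<in> bits \<rho> \<Longrightarrow> dec (enc s x) = (s, x)"
    and "secure_sketch M dis m m' t
           (\<lambda>w. map_pmf (SS w) (unif k))
           (\<lambda>w' s. map_pmf (Rec w' s) (unif k'))"
    and "avg_strong_extractor n m' l \<epsilon> \<rho> Ext"
  shows "fuzzy_extractor M dis m l t \<epsilon>
           (\<lambda>w. map_pmf (\<lambda>(r, x). sketch_gen repr enc SS Ext w r x) (pair_pmf (unif k) (unif \<rho>)))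
           (\<lambda>w' P. map_pmf (sketch_rep repr dec Rec Ext w' P) (unif k'))"
proof -
  define Gen where "Gen = (\<lambda>w. map_pmf (\<lambda>(r, x). sketch_gen repr enc SS Ext w r x)
    (pair_pmf (unif k) (unif \<rho>)))"
  define Rep where "Rep = (\<lambda>w' P. map_pmf (sketch_rep repr dec Rec Ext w' P) (unif k'))"
  note dec_enc = assms(5)
  have repr_bits: "repr w \<in> bits n" if "w \<in> M" for w
    using that assms(4) by auto
  have Ext_bits: "Ext v x \<in> bits l" if "v \<in> bits n" "x \<in> bits \<rho>" for v x
    using assms(7) that by (auto simp: avg_strong_extractor_def)
  have set_Gen: "set_pmf (Gen w)
      = (\<lambda>(r, x). (Ext (repr w) x, enc (SS w r) x)) ` (bits k \<times> bits \<rho>)" for w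
    by (simp add: Gen_def set_pmf_unif sketch_gen_def)

  have range: "\<forall>(R, P)\<in>set_pmf (Gen w). R \<in> bits l" if "w \<in> M" for w
    using that by (auto simp: set_Gen repr_bits Ext_bits)

  have correct: "\<forall>(R, P)\<in>set_pmf (Gen w). Rep w' P = return_pmf R"
    if "w \<in> M" "w' \<in> M" "dis w w' \<le> t" for w w'
  proof -
    have "Rep w' (enc (SS w r) x) = return_pmf (Ext (repr w) x)"
      if "r \<in> bits k" "x \<in> bits \<rho>" for r x
    proof -
      have "SS w r \<in> set_pmf (map_pmf (SS w) (unif k))"
        using that by (simp add: set_pmf_unif)
      then have "map_pmf (Rec w' (SS w r)) (unif k') = return_pmf w"
        using assms(6) \<open>w \<in> M\<close> \<open>w' \<in> M\<close> \<open>dis w w' \<le> t\<close>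
        unfolding secure_sketch_def by blast
      then have "Rec w' (SS w r) c = w" if "c \<in> set_pmf (unif k')" for c
        using that by (rule map_pmf_eq_return_pmfD)
      \<comment> \<open>On every coin string \<open>Rec\<close> returns \<open>w\<close>, so
        \<open>Rep\<close> is constant in its coins and its output distribution collapses to a
        point.\<close>
      then have "Rep w' (enc (SS w r) x) = map_pmf (\<lambda>_. Ext (repr w) x) (unif k')"
        unfolding Rep_def using that
        by (intro map_pmf_cong) (auto simp: sketch_rep_def dec_enc)
      then show ?thesis by simp
    qed
    then show ?thesis
      by (auto simp: set_Gen)
  qed

  have secure: "SD (bind_pmf W Gen) (pair_pmf (unif l) (map_pmf snd (bind_pmf W Gen))) \<le> \<epsilon>"
    if W: "set_pmf W \<subseteq> M" "min_entropy W \<ge> m" for W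
  proof -
    \<comment> \<open>\<open>WS\<close> joins input and sketch, and \<open>WI\<close> is its
      bit-string form. \<open>E\<close> and \<open>U\<close> are the real and ideal triples of the
      extractor, and \<open>f\<close> packs seed and sketch into \<open>P\<close>.\<close>
    define WS where "WS = bind_pmf W (\<lambda>w. map_pmf (\<lambda>s. (w, s)) (map_pmf (SS w) (unif k)))"
    define WI where "WI = map_pmf (apfst repr) WS"
    define E where "E = map_pmf (\<lambda>((w, i), x). (Ext w x, x, i)) (pair_pmf WI (unif \<rho>))"
    define U where "U = pair_pmf (unif l) (pair_pmf (unif \<rho>) (map_pmf snd WI))"
    define f where "f = (\<lambda>(R, x, s). (R :: bool list, enc s x))"
    have fst_WS: "fst ` set_pmf WS \<subseteq> M"
      using W(1) by (auto simp: WS_def)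
    then have "inj_on repr (fst ` set_pmf WS)"
      using assms(3) inj_on_subset by blast
    then have "avg_min_entropy WI = avg_min_entropy WS"
      unfolding WI_def by (rule avg_min_entropy_map_fst_inj)
    moreover have "avg_min_entropy WS \<ge> m'"
      using assms(6) W unfolding secure_sketch_def WS_def by blast
    moreover have "fst ` set_pmf WI \<subseteq> bits n"
      using fst_WS repr_bits by (force simp: WI_def)
    ultimately have EU: "SD E U \<le> \<epsilon>"
      using assms(7) unfolding avg_strong_extractor_def E_def U_def by simp
    \<comment> \<open>The seed is confined to \<open>bits \<rho>\<close> because \<open>dec\<close>
      is known to invert \<open>enc\<close> only there.\<close>
    have "inj_on f (UNIV \<times> bits \<rho> \<times> UNIV)"
      by (rule inj_onI) (auto simp: f_def dest!: arg_cong[where f = dec] simp: dec_enc)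
    moreover have "set_pmf E \<union> set_pmf U \<subseteq> UNIV \<times> bits \<rho> \<times> UNIV"
      by (auto simp: E_def U_def set_pmf_unif)
    ultimately have "SD (map_pmf f E) (map_pmf f U) = SD E U"
      using SD_map_pmf_inj inj_on_subset by blast
    \<comment> \<open>Both sides draw \<open>w\<close>, \<open>r\<close>, \<open>x\<close> in this
      order, so the monad laws suffice.\<close>
    moreover have bind_Gen: "bind_pmf W Gen = map_pmf f E"
      unfolding Gen_def E_def WI_def WS_def f_def sketch_gen_def pair_pmf_def map_pmf_def
      by (simp add: bind_assoc_pmf bind_return_pmf)
    moreover have "pair_pmf (unif l) (map_pmf snd (bind_pmf W Gen)) = map_pmf f U"
    proof -
      \<comment> \<open>Dropping \<open>R\<close> leaves the sketch and an independent seed.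
        \<open>E\<close> draws the seed last and \<open>U\<close> draws it before the sketch, hence
        the commutation.\<close>
      have "map_pmf snd (map_pmf f E) = map_pmf (\<lambda>(x, s). enc s x)
          (pair_pmf (unif \<rho>) (map_pmf snd WI))"
        unfolding E_def f_def
        by (subst pair_commute_pmf)
           (simp add: map_pmf_comp case_prod_unfold pair_map_pmf2)
      then show ?thesis
        unfolding bind_Gen U_def f_def
        by (simp add: pair_map_pmf2 map_pmf_comp case_prod_unfold apsnd_def map_prod_def)
    qed
    ultimately show ?thesis
      using EU by simp
  qed

  show ?thesis
    using range correct secure
    unfolding fuzzy_extractor_def Gen_def[symmetric] Rep_def[symmetric] by blast
qed

end
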